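(* Let $\mathcal H$ be a complex Hilbert space, let $m\ge1$ be an integer, and let $T\in\mathcal B(\mathcal H)$ be an $m$-partial isometry. (a) If $m$ is odd, then $\sigma(T)\subseteq\{z\in\mathbb C:|z|\le1\}$. In particular, $r(T)\le1$. (b) If $m$ is even, then $\sigma(T)\subseteq\{z\in\mathbb C:|z|\le\sqrt2\}$ and $\sigma_{\mathrm p}(T)\subseteq\{z\in\mathbb C:|z|<\sqrt2\}$. In particular, $r(T)\le\sqrt2$.
   Context: $\mathcal B(\mathcal H)$ denotes the bounded linear operators on $\mathcal H$. For $T\in\mathcal B(\mathcal H)$ and an integer $m\ge1$, let $\beta_m(T)=\sum_{k=0}^m(-1)^{m-k}\binom mk T^{*k}T^k$. $T$ is an $m$-partial isometry if $T\beta_m(T)=0$. $\sigma(T)$ is the spectrum, $\sigma_{\mathrm p}(T)$ the point spectrum (set of eigenvalues), and $r(T)$ the spectral radius of $T$. *)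

theory Defs
  imports "HOL-Analysis.Analysis"
begin

class complex_vector = real_vector +
  fixes scaleC :: "complex \<Rightarrow> 'a \<Rightarrow> 'a" (infixr "*\<^sub>C" 75)
  assumes scaleC_add_right: "a *\<^sub>C (x + y) = a *\<^sub>C x + a *\<^sub>C y"
    and scaleC_add_left: "(a + b) *\<^sub>C x = a *\<^sub>C x + b *\<^sub>C x"
    and scaleC_scaleC: "a *\<^sub>C (b *\<^sub>C x) = (a * b) *\<^sub>C x"
    and scaleR_scaleC: "r *\<^sub>R x = complex_of_real r *\<^sub>C x"

text \<open>The inner product is linear in the first argument. The law \<open>1 *\<^sub>C x = x\<close> follows from
  \<open>scaleR_scaleC\<close>, and \<open>Im (cinner x x) = 0\<close> from \<open>cinner_commute\<close>.\<close>

class complex_inner = complex_vector + real_normed_vector +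
  fixes cinner :: "'a \<Rightarrow> 'a \<Rightarrow> complex"
  assumes cinner_commute: "cinner x y = cnj (cinner y x)"
    and cinner_add_left: "cinner (x + y) z = cinner x z + cinner y z"
    and cinner_scaleC_left: "cinner (a *\<^sub>C x) y = a * cinner x y"
    and cinner_ge_zero: "0 \<le> Re (cinner x x)"
    and cinner_eq_zero_iff: "cinner x x = 0 \<longleftrightarrow> x = 0"
    and norm_eq_sqrt_cinner: "norm x = sqrt (Re (cinner x x))"

class chilbert_space = complex_inner + complete_space

instance chilbert_space \<subseteq> banach ..

instantiation complex :: chilbert_space
begin

definition scaleC_complex :: "complex \<Rightarrow> complex \<Rightarrow> complex" where
  "scaleC_complex a x = a * x"

definition cinner_complex :: "complex \<Rightarrow> complex \<Rightarrow> complex" where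
  "cinner_complex x y = x * cnj y"

instance
  by standard
    (auto simp: scaleC_complex_def cinner_complex_def algebra_simps scaleR_conv_of_real
      cmod_def power2_eq_square)

end

definition bounded_clinear :: "('a::complex_inner \<Rightarrow> 'b::complex_inner) \<Rightarrow> bool" where
  "bounded_clinear T \<longleftrightarrow> bounded_linear T \<and> (\<forall>c x. T (c *\<^sub>C x) = c *\<^sub>C T x)"

text \<open>For bounded \<open>T\<close> on a Hilbert space the adjoint exists by the Riesz representation theorem
  and is unique because \<open>cinner\<close> is definite.\<close>

definition cadjoint :: "('a::chilbert_space \<Rightarrow> 'a) \<Rightarrow> 'a \<Rightarrow> 'a" where
  "cadjoint T = (THE S. \<forall>x y. cinner (T x) y = cinner x (S y))"

definition beta_op :: "nat \<Rightarrow> ('a::chilbert_space \<Rightarrow> 'a) \<Rightarrow> 'a \<Rightarrow> 'a" where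
  "beta_op m T x =
     (\<Sum>k=0..m. ((-1) ^ (m - k) * of_nat (m choose k)) *\<^sub>C (cadjoint T ^^ k) ((T ^^ k) x))"

definition m_partial_isometry :: "nat \<Rightarrow> ('a::chilbert_space \<Rightarrow> 'a) \<Rightarrow> bool" where
  "m_partial_isometry m T \<longleftrightarrow> (\<forall>x. T (beta_op m T x) = 0)"

definition op_spectrum :: "('a::chilbert_space \<Rightarrow> 'a) \<Rightarrow> complex set" where
  "op_spectrum T = {z. \<not> (\<exists>S. bounded_clinear S \<and>
     (\<forall>x. S (T x - z *\<^sub>C x) = x) \<and> (\<forall>x. T (S x) - z *\<^sub>C S x = x))}"

definition op_point_spectrum :: "('a::chilbert_space \<Rightarrow> 'a) \<Rightarrow> complex set" where
  "op_point_spectrum T = {z. \<exists>x. x \<noteq> 0 \<and> T x = z *\<^sub>C x}"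

text \<open>Inserting \<open>0\<close> does not change the supremum of the moduli of a nonempty spectrum. It only
  fixes the value \<open>0\<close> on the zero space, where the spectrum is empty and \<open>Sup {}\<close> is unspecified
  on the reals.\<close>

definition op_spectral_radius :: "('a::chilbert_space \<Rightarrow> 'a) \<Rightarrow> real" where
  "op_spectral_radius T = Sup (insert 0 (cmod ` op_spectrum T))"

end

theory Submission
  imports Defs
begin

text \<open>
  Put \<open>E = (-1)\<^sup>m \<beta>\<^sub>m(T)\<close>, a self-adjoint operator. It fixes \<open>ker T\<close> pointwise, and the hypothesis
  puts its range inside \<open>ker T\<close>; hence \<open>E\<close> is the orthogonal projection onto \<open>ker T\<close> and
  \<open>0 \<le> (-1)\<^sup>m (\<beta>\<^sub>m(T) x, x) = \<parallel>E x\<parallel>\<^sup>2 \<le> \<parallel>x\<parallel>\<^sup>2\<close>, with equality on the right only for \<open>x \<in> ker T\<close>.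
  Along unit approximate eigenvectors for \<open>z\<close> the middle term tends to \<open>(1 - |z|\<^sup>2)\<^sup>m\<close>, so an
  approximate eigenvalue has \<open>|z| \<le> 1\<close> for odd \<open>m\<close> and \<open>|z| \<le> \<surd>2\<close> for even \<open>m\<close>. Outside that disc
  every \<open>T - z\<close> is therefore bounded below, and along a ray to infinity, where \<open>T - z\<close> is
  invertible for large \<open>z\<close>, invertibility is an open and closed condition.
\<close>

section \<open>Complex inner product spaces\<close>

lemma scaleC_one [simp]: "1 *\<^sub>C (x::'a::complex_vector) = x"
  using scaleR_scaleC[of 1 x] by simp

lemma scaleC_zero_left [simp]: "0 *\<^sub>C (x::'a::complex_vector) = 0"
  using scaleR_scaleC[of 0 x] by simp

lemma scaleC_zero_right [simp]: "a *\<^sub>C (0::'a::complex_vector) = 0"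
  using scaleC_add_right[of a 0 "0::'a"] by simp

lemma scaleC_minus_right: "a *\<^sub>C (- x) = - (a *\<^sub>C (x::'a::complex_vector))"
  using scaleC_add_right[of a x "- x"] by (simp add: eq_neg_iff_add_eq_0 add.commute)

lemma scaleC_diff_right: "a *\<^sub>C (x - y) = a *\<^sub>C x - a *\<^sub>C (y::'a::complex_vector)"
  using scaleC_add_right[of a x "- y"] by (simp add: scaleC_minus_right)

lemma scaleC_minus_left: "(- a) *\<^sub>C x = - (a *\<^sub>C (x::'a::complex_vector))"
  using scaleC_add_left[of a "- a" x] by (simp add: eq_neg_iff_add_eq_0 add.commute)

lemma scaleC_diff_left: "(a - b) *\<^sub>C x = a *\<^sub>C x - b *\<^sub>C (x::'a::complex_vector)"
  using scaleC_add_left[of a "- b" x] by (simp add: scaleC_minus_left)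

lemma cinner_add_right: "cinner x (y + z) = cinner x y + cinner x (z::'a::complex_inner)"
  by (metis cinner_add_left cinner_commute complex_cnj_add)

lemma cinner_scaleC_right: "cinner x (a *\<^sub>C y) = cnj a * cinner x (y::'a::complex_inner)"
  by (metis cinner_scaleC_left cinner_commute complex_cnj_mult)

lemma cinner_zero_left [simp]: "cinner 0 (y::'a::complex_inner) = 0"
  using cinner_scaleC_left[of 0 0 y] by simp

lemma cinner_zero_right [simp]: "cinner (y::'a::complex_inner) 0 = 0"
  using cinner_scaleC_right[of y 0 0] by simp

lemma cinner_minus_left: "cinner (- x) (y::'a::complex_inner) = - cinner x y"
  using cinner_add_left[of x "- x" y] by (simp add: eq_neg_iff_add_eq_0 add.commute)

lemma cinner_minus_right: "cinner x (- y::'a::complex_inner) = - cinner x y"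
  using cinner_add_right[of x y "- y"] by (simp add: eq_neg_iff_add_eq_0 add.commute)

lemma cinner_diff_left: "cinner (x - y) (z::'a::complex_inner) = cinner x z - cinner y z"
  using cinner_add_left[of x "- y" z] by (simp add: cinner_minus_left)

lemma cinner_diff_right: "cinner z (x - y::'a::complex_inner) = cinner z x - cinner z y"
  using cinner_add_right[of z x "- y"] by (simp add: cinner_minus_right)

lemma cinner_sum_left:
  "cinner (\<Sum>i\<in>I. f i) (y::'a::complex_inner) = (\<Sum>i\<in>I. cinner (f i) y)"
  by (induction I rule: infinite_finite_induct) (auto simp: cinner_add_left)

lemma cinner_eqI: "(\<And>y. cinner u y = cinner v y) \<Longrightarrow> u = (v::'a::complex_inner)"
  by (metis cinner_diff_left cinner_eq_zero_iff right_minus_eq)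

section \<open>Norm identities and the Cauchy-Schwarz bound\<close>

lemma norm_squared_cinner: "(norm (x::'a::complex_inner))\<^sup>2 = Re (cinner x x)"
  by (simp add: norm_eq_sqrt_cinner cinner_ge_zero)

lemma cinner_self: "cinner x (x::'a::complex_inner) = of_real ((norm x)\<^sup>2)"
  using cinner_commute[of x x] by (simp add: norm_squared_cinner complex_eq_iff)

lemma Re_cinner_commute: "Re (cinner x (y::'a::complex_inner)) = Re (cinner y x)"
  by (metis cinner_commute complex_cnj(1) complex.collapse complex.sel(1))

lemma norm_add_squared:
  "(norm (x + y::'a::complex_inner))\<^sup>2 = (norm x)\<^sup>2 + 2 * Re (cinner x y) + (norm y)\<^sup>2"
  by (simp add: norm_squared_cinner cinner_add_left cinner_add_right Re_cinner_commute[of y x])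

lemma norm_diff_squared:
  "(norm (x - y::'a::complex_inner))\<^sup>2 = (norm x)\<^sup>2 - 2 * Re (cinner x y) + (norm y)\<^sup>2"
  by (simp add: norm_squared_cinner cinner_diff_left cinner_diff_right Re_cinner_commute[of y x])

lemma norm_scaleC: "norm (a *\<^sub>C (x::'a::complex_inner)) = cmod a * norm x"
proof -
  have "cinner (a *\<^sub>C x) (a *\<^sub>C x) = (a * cnj a) * cinner x x"
    by (simp add: cinner_scaleC_left cinner_scaleC_right)
  also have "\<dots> = of_real ((cmod a * norm x)\<^sup>2)"
    by (simp add: cinner_self power_mult_distrib flip: complex_norm_square)
  finally have "(norm (a *\<^sub>C x))\<^sup>2 = (cmod a * norm x)\<^sup>2"
    by (simp add: norm_squared_cinner)
  then show ?thesis by (simp add: power2_eq_iff_nonneg)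
qed

text \<open>Expanding both sides of the squared triangle inequality, which the class of normed
  spaces supplies as an axiom, leaves exactly the Cauchy-Schwarz bound for the real part. The sign
  is handled by passing to \<open>- x\<close>.\<close>

lemma abs_Re_cinner_le: "\<bar>Re (cinner x (y::'a::complex_inner))\<bar> \<le> norm x * norm y"
proof -
  have *: "Re (cinner u y) \<le> norm u * norm y" for u
  proof -
    have "(norm (u + y))\<^sup>2 \<le> (norm u + norm y)\<^sup>2"
      by (intro power_mono norm_triangle_ineq) auto
    then show ?thesis by (simp add: norm_add_squared power2_sum)
  qed
  from *[of x] *[of "- x"] show ?thesis by (simp add: cinner_minus_left abs_le_iff)
qed

lemma bounded_linear_Re_cinner_left: "bounded_linear (\<lambda>x::'a::complex_inner. Re (cinner x y))"
  by (rule bounded_linear_intro[where K = "norm y"])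
    (auto simp: cinner_add_left scaleR_scaleC cinner_scaleC_left abs_Re_cinner_le)

text \<open>The parallelogram law, with the midpoint made explicit so that a minimality bound can be
  applied there.\<close>

lemma parallelogram_midpoint:
  "(norm (x - y))\<^sup>2 / 2 = (norm x)\<^sup>2 + (norm y)\<^sup>2 - 2 * (norm ((1/2) *\<^sub>R (x + y)))\<^sup>2"
  for x :: "'a::complex_inner"
proof -
  have "(norm ((1/2) *\<^sub>R (x + y)))\<^sup>2 = (norm (x + y))\<^sup>2 / 4"
    unfolding norm_scaleR by (simp add: power_mult_distrib power_divide)
  then show ?thesis by (simp add: norm_add_squared norm_diff_squared field_simps)
qed

section \<open>The adjoint\<close>

text \<open>The representing vector is the minimiser of \<open>\<parallel>x\<parallel>\<^sup>2 - 2 f x\<close>; minimising sequences are Cauchy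
  by the parallelogram law.\<close>

lemma riesz_real:
  fixes f :: "'a::chilbert_space \<Rightarrow> real"
  assumes "bounded_linear f"
  shows "\<exists>u. \<forall>x. f x = Re (cinner x u)"
proof -
  interpret f: bounded_linear f by fact
  define J where "J x = (norm x)\<^sup>2 - 2 * f x" for x
  obtain K where K: "\<And>x. \<bar>f x\<bar> \<le> norm x * K"
    using f.bounded by auto
  have J_bound: "- K\<^sup>2 \<le> J x" for x
  proof -
    have "0 \<le> (norm x - K)\<^sup>2" by simp
    then show ?thesis using K[of x] unfolding J_def power2_diff by linarith
  qed
  define d where "d = Inf (range J)"
  have bdd: "bdd_below (range J)" using J_bound by (intro bdd_belowI[of _ "- K\<^sup>2"]) auto
  have d_le: "d \<le> J x" for x unfolding d_def by (intro cInf_lower bdd) auto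
  have "\<exists>x. J x < d + 1 / Suc n" for n
    using cInf_lessD[of "range J" "d + 1 / Suc n"] unfolding d_def by auto
  then obtain X where X: "\<And>n. J (X n) < d + 1 / Suc n" by metis
  have X_dist: "(norm (X i - X j))\<^sup>2 \<le> 2 / Suc i + 2 / Suc j" for i j
  proof -
    \<comment> \<open>The linear terms of \<open>J\<close> cancel in this combination, since
      \<open>f\<close> at the midpoint is the mean of its values.\<close>
    have "(norm (X i - X j))\<^sup>2 / 2 = J (X i) + J (X j) - 2 * J ((1/2) *\<^sub>R (X i + X j))"
      unfolding parallelogram_midpoint J_def f.scaleR f.add by (simp add: field_simps)
    also have "\<dots> \<le> 1 / Suc i + 1 / Suc j"
      using X[of i] X[of j] d_le[of "(1/2) *\<^sub>R (X i + X j)"] by linarith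
    finally show ?thesis by simp
  qed
  have "Cauchy X"
  proof (rule metric_CauchyI)
    fix e :: real assume "0 < e"
    then have "0 < e\<^sup>2 / 4" by simp
    then obtain N where N: "1 / Suc N < e\<^sup>2 / 4" using nat_approx_posE by blast
    have "dist (X i) (X j) < e" if "N \<le> i" "N \<le> j" for i j
    proof -
      have "1 / real (Suc i) \<le> 1 / Suc N" "1 / real (Suc j) \<le> 1 / Suc N"
        using that by (auto simp: field_simps)
      then have "(norm (X i - X j))\<^sup>2 < e\<^sup>2" using X_dist[of i j] N by linarith
      then show ?thesis using \<open>0 < e\<close> by (simp add: dist_norm power_less_imp_less_base)
    qed
    then show "\<exists>M. \<forall>i\<ge>M. \<forall>j\<ge>M. dist (X i) (X j) < e" by blast
  qed
  then obtain u where u: "X \<longlonglongrightarrow> u" using Cauchy_convergent_iff convergent_def by blast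
  have "(\<lambda>n. J (X n)) \<longlonglongrightarrow> J u" unfolding J_def by (intro tendsto_intros u f.tendsto)
  moreover have "(\<lambda>n. d + 1 / Suc n) \<longlonglongrightarrow> d + 0"
    by (intro tendsto_intros LIMSEQ_Suc lim_1_over_n)
  ultimately have "J u \<le> d + 0" by (rule LIMSEQ_le) (use X less_imp_le in blast)
  then have u_min: "J u \<le> J x" for x using d_le[of x] by simp
  have "f v = Re (cinner v u)" for v
  proof -
    \<comment> \<open>\<open>a\<close> is half the derivative of \<open>J\<close> at
      \<open>u\<close> in direction \<open>v\<close>, so the aim is \<open>a = 0\<close>. The extra
      1 in \<open>b\<close> keeps the division by \<open>b\<close> legitimate when
      \<open>v = 0\<close>, and it produces the term \<open>- t\<^sup>2\<close> below.\<close>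
    define a where "a = Re (cinner u v) - f v"
    define b where "b = 1 + (norm v)\<^sup>2"
    have "0 < b" unfolding b_def by (simp add: add_pos_nonneg)
    define t where "t = - a / b"
    have "J (u + t *\<^sub>R v) = J u + 2 * t * a + t\<^sup>2 * (norm v)\<^sup>2"
      unfolding J_def a_def norm_add_squared f.add f.scaleR norm_scaleR
      by (simp add: power_mult_distrib scaleR_scaleC cinner_scaleC_right algebra_simps)
    then have "0 \<le> 2 * t * a + t\<^sup>2 * (b - 1)" using u_min[of "u + t *\<^sub>R v"] by (simp add: b_def)
    also have "\<dots> = - a\<^sup>2 / b - t\<^sup>2"
      using \<open>0 < b\<close> by (simp add: t_def field_simps power2_eq_square)
    finally have "a\<^sup>2 / b + t\<^sup>2 \<le> 0" by simp
    moreover have "0 \<le> a\<^sup>2 / b" using \<open>0 < b\<close> by simp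
    ultimately have "t\<^sup>2 \<le> 0" by linarith
    then have "a = 0" using \<open>0 < b\<close> by (simp add: t_def)
    then show ?thesis by (simp add: a_def Re_cinner_commute)
  qed
  then show ?thesis by blast
qed

text \<open>Riesz representation of the real functional \<open>Re (cinner (T x) y)\<close> provides
  a candidate for the adjoint; definiteness of \<open>cinner\<close> makes it unique, so the
  description in \<open>cadjoint\<close> denotes it.\<close>

lemma cinner_cadjoint:
  fixes T :: "'a::chilbert_space \<Rightarrow> 'a"
  assumes "bounded_clinear T"
  shows "cinner (T x) y = cinner x (cadjoint T y)"
proof -
  have T: "bounded_linear T" "\<And>c x. T (c *\<^sub>C x) = c *\<^sub>C T x"
    using assms by (auto simp: bounded_clinear_def)
  have "\<exists>u. \<forall>x. cinner (T x) y = cinner x u" for y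
  proof -
    obtain u where u: "\<And>x. Re (cinner (T x) y) = Re (cinner x u)"
      using riesz_real[OF bounded_linear_compose[OF bounded_linear_Re_cinner_left T(1)]] by blast
    \<comment> \<open>Multiplying \<open>x\<close> by the imaginary unit turns imaginary parts into
      negated real parts on both sides.\<close>
    have "Im (cinner (T x) y) = Im (cinner x u)" for x
      using u[of "\<i> *\<^sub>C x"] by (simp add: T(2) cinner_scaleC_left)
    with u show ?thesis by (auto simp: complex_eq_iff)
  qed
  then obtain S where S: "\<And>x y. cinner (T x) y = cinner x (S y)" by metis
  have "cadjoint T = S" unfolding cadjoint_def
  proof (rule the_equality)
    show "\<forall>x y. cinner (T x) y = cinner x (S y)" using S by simp
  next
    fix S' assume S': "\<forall>x y. cinner (T x) y = cinner x (S' y)"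
    show "S' = S"
    proof
      fix y
      have "cinner x (S' y) = cinner x (S y)" for x using S' S by simp
      then show "S' y = S y" by (metis cinner_eqI cinner_commute)
    qed
  qed
  then show ?thesis by (simp add: S)
qed

lemma cinner_cadjoint_funpow:
  fixes T :: "'a::chilbert_space \<Rightarrow> 'a"
  assumes "bounded_clinear T"
  shows "cinner ((cadjoint T ^^ k) x) y = cinner x ((T ^^ k) y)"
proof (induction k arbitrary: y)
  case (Suc k)
  have "cinner (cadjoint T u) y = cinner u (T y)" for u
    using cinner_cadjoint[OF assms, of y u] cinner_commute[of "cadjoint T u" y]
      cinner_commute[of u "T y"] by simp
  with Suc show ?case by (simp add: funpow_swap1[of T])
qed auto

text \<open>Moving the adjoint powers across the inner product leaves only powers of
  \<open>T\<close>; from here on \<open>beta_op\<close> is handled through this form.\<close>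

lemma cinner_beta_op:
  fixes T :: "'a::chilbert_space \<Rightarrow> 'a"
  assumes "bounded_clinear T"
  shows "cinner (beta_op m T x) y =
    (\<Sum>k=0..m. ((-1) ^ (m - k) * of_nat (m choose k)) * cinner ((T ^^ k) x) ((T ^^ k) y))"
  by (simp add: beta_op_def cinner_sum_left cinner_scaleC_left cinner_cadjoint_funpow[OF assms])

section \<open>The spectrum of an operator that is bounded below outside a disc\<close>

text \<open>The lower bound gives injectivity and bounds the inverse by \<open>1 / c\<close>, so
  surjectivity is all that invertibility still requires.\<close>

lemma not_in_op_spectrumI:
  fixes T :: "'a::chilbert_space \<Rightarrow> 'a"
  assumes T: "bounded_clinear T" and "0 < c"
    and below: "\<And>x. c * norm x \<le> norm (T x - z *\<^sub>C x)"
    and "surj (\<lambda>x. T x - z *\<^sub>C x)"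
  shows "z \<notin> op_spectrum T"
proof -
  interpret T: bounded_linear T using T by (simp add: bounded_clinear_def)
  have TC: "T (a *\<^sub>C x) = a *\<^sub>C T x" for a x using T by (simp add: bounded_clinear_def)
  define A where "A x = T x - z *\<^sub>C x" for x
  have A_add: "A (x + y) = A x + A y" for x y by (simp add: A_def T.add scaleC_add_right)
  have A_diff: "A (x - y) = A x - A y" for x y by (simp add: A_def T.diff scaleC_diff_right)
  have A_scale: "A (a *\<^sub>C x) = a *\<^sub>C A x" for a x
    by (simp add: A_def TC scaleC_diff_right scaleC_scaleC mult.commute)
  have "inj A"
  proof (rule injI)
    fix x y assume "A x = A y"
    then have "c * norm (x - y) \<le> 0" using below[of "x - y"] A_diff[of x y] by (simp add: A_def)
    then show "x = y" using \<open>0 < c\<close> by (simp add: mult_le_0_iff)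
  qed
  define S where "S = inv A"
  have AS: "A (S x) = x" for x unfolding S_def
    by (rule surj_f_inv_f) (use assms(4) in \<open>simp add: A_def[abs_def]\<close>)
  have SA: "S (A x) = x" for x using \<open>inj A\<close> by (simp add: S_def)
  have S_scale: "S (a *\<^sub>C x) = a *\<^sub>C S x" for a x by (metis A_scale AS SA)
  have "bounded_linear S"
  proof (rule bounded_linear_intro[where K = "1 / c"])
    show "S (x + y) = S x + S y" for x y by (metis A_add AS SA)
    show "S (r *\<^sub>R x) = r *\<^sub>R S x" for r x by (simp add: scaleR_scaleC S_scale)
    show "norm (S x) \<le> norm x * (1 / c)" for x
      using below[of "S x"] AS[of x] \<open>0 < c\<close> by (simp add: A_def field_simps)
  qed
  then have "bounded_clinear S" by (simp add: bounded_clinear_def S_scale)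
  then show ?thesis using AS SA unfolding op_spectrum_def A_def by blast
qed

text \<open>With \<open>S\<close> a right inverse of \<open>T - z\<close>, a solution of
  \<open>T x - w x = y\<close> is a fixed point of the map sending \<open>x\<close> to
  \<open>S (y + (w - z) x)\<close>, a contraction with constant
  \<open>cmod (w - z) / c\<close>.\<close>

lemma surj_diff_scaleC_stable:
  fixes T :: "'a::chilbert_space \<Rightarrow> 'a"
  assumes T: "bounded_clinear T" and "0 < c"
    and below: "\<And>x. c * norm x \<le> norm (T x - z *\<^sub>C x)"
    and surj: "surj (\<lambda>x. T x - z *\<^sub>C x)"
    and w: "cmod (w - z) < c"
  shows "surj (\<lambda>x. T x - w *\<^sub>C x)"
proof -
  interpret T: bounded_linear T using T by (simp add: bounded_clinear_def)
  obtain S where S: "\<And>y. T (S y) - z *\<^sub>C S y = y" using surj unfolding surj_def by metis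
  have S_lip: "c * norm (S y - S y') \<le> norm (y - y')" for y y'
  proof -
    have "T (S y - S y') - z *\<^sub>C (S y - S y')
        = (T (S y) - z *\<^sub>C S y) - (T (S y') - z *\<^sub>C S y')"
      by (simp add: T.diff scaleC_diff_right)
    then show ?thesis using below[of "S y - S y'"] by (simp add: S)
  qed
  have "\<exists>x. T x - w *\<^sub>C x = y" for y
  proof -
    define F where "F x = S (y + (w - z) *\<^sub>C x)" for x
    have "\<exists>!x. F x = x"
    proof (rule banach_fix_type[where c = "cmod (w - z) / c"])
      show "\<forall>x x'. dist (F x) (F x') \<le> cmod (w - z) / c * dist x x'"
      proof (intro allI)
        fix x x'
        have "c * norm (F x - F x') \<le> cmod (w - z) * norm (x - x')"
          using S_lip[of "y + (w - z) *\<^sub>C x" "y + (w - z) *\<^sub>C x'"]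
          by (simp add: F_def norm_scaleC flip: scaleC_diff_right)
        then show "dist (F x) (F x') \<le> cmod (w - z) / c * dist x x'"
          using \<open>0 < c\<close> by (simp add: dist_norm field_simps)
      qed
    qed (use w \<open>0 < c\<close> in auto)
    then obtain x where "F x = x" by auto
    then have "T x - z *\<^sub>C x = y + (w - z) *\<^sub>C x" using S F_def by metis
    then show ?thesis by (intro exI[of _ x]) (simp add: scaleC_diff_left)
  qed
  then show ?thesis unfolding surj_def by metis
qed

text \<open>The equation is rewritten as \<open>x = (T x - y) / z\<close>, whose right-hand side is
  a contraction with constant \<open>K / cmod z\<close>. This plays the part of the Neumann
  series.\<close>

lemma surj_diff_scaleC_large:
  fixes T :: "'a::chilbert_space \<Rightarrow> 'a"
  assumes T: "bounded_clinear T" and K: "\<And>x. norm (T x) \<le> K * norm x" and "0 \<le> K" "K < cmod z"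
  shows "surj (\<lambda>x. T x - z *\<^sub>C x)"
proof -
  interpret T: bounded_linear T using T by (simp add: bounded_clinear_def)
  have z: "z \<noteq> 0" using assms(3,4) by auto
  have "\<exists>x. T x - z *\<^sub>C x = y" for y
  proof -
    define F where "F x = (1 / z) *\<^sub>C (T x - y)" for x
    have "\<exists>!x. F x = x"
    proof (rule banach_fix_type[where c = "K / cmod z"])
      show "\<forall>x x'. dist (F x) (F x') \<le> K / cmod z * dist x x'"
      proof (intro allI)
        fix x x'
        have "F x - F x' = (1 / z) *\<^sub>C T (x - x')"
          by (simp add: F_def T.diff flip: scaleC_diff_right)
        then show "dist (F x) (F x') \<le> K / cmod z * dist x x'"
          using K[of "x - x'"] z by (simp add: dist_norm norm_scaleC norm_divide divide_right_mono)
      qed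
    qed (use assms(3,4) z in auto)
    then obtain x where "F x = x" by auto
    then have "z *\<^sub>C x = T x - y" using z unfolding F_def by (metis scaleC_scaleC scaleC_one
        nonzero_mult_div_cancel_left times_divide_eq_right mult.right_neutral)
    then show ?thesis by (intro exI[of _ x]) simp
  qed
  then show ?thesis unfolding surj_def by metis
qed

text \<open>The ray of points \<open>t * z\<close> with \<open>t \<ge> 1\<close> stays outside the
  disc. Surjectivity is locally constant along it and holds far out, hence holds at
  \<open>t = 1\<close>.\<close>

lemma op_spectrum_subset_disc:
  fixes T :: "'a::chilbert_space \<Rightarrow> 'a"
  assumes T: "bounded_clinear T" and "0 \<le> R"
    and below: "\<And>z. R < cmod z \<Longrightarrow> \<exists>c>0. \<forall>x. c * norm x \<le> norm (T x - z *\<^sub>C x)"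
  shows "op_spectrum T \<subseteq> {z. cmod z \<le> R}"
proof
  fix z assume z: "z \<in> op_spectrum T"
  interpret T: bounded_linear T using T by (simp add: bounded_clinear_def)
  show "z \<in> {z. cmod z \<le> R}"
  proof (rule ccontr)
    assume "z \<notin> {z. cmod z \<le> R}"
    then have zR: "R < cmod z" by simp
    define U where "U = {1::real..}"
    define s where "s t \<longleftrightarrow> surj (\<lambda>x. T x - (of_real t * z) *\<^sub>C x)" for t
    have "\<exists>e>0. \<forall>t'. dist t' t < e \<longrightarrow> (s t' \<longleftrightarrow> s t)" if "t \<in> U" for t
    proof -
      have "cmod z \<le> cmod (of_real t * z)"
        using that by (simp add: U_def norm_mult mult_le_cancel_right1)
      then obtain c where "0 < c" and c: "\<And>x. c * norm x \<le> norm (T x - (of_real t * z) *\<^sub>C x)"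
        using below[of "of_real t * z"] zR by auto
      \<comment> \<open>Half of the admissible radius is used: the bound \<open>c / 2\<close> then
        survives at \<open>t'\<close>, so stability applies in both directions.\<close>
      have "s t' \<longleftrightarrow> s t" if t': "dist t' t < c / (2 * cmod z)" for t'
      proof -
        have "cmod (of_real t' * z - of_real t * z) = dist t' t * cmod z"
          by (simp add: dist_norm norm_mult flip: left_diff_distrib of_real_diff)
        also have "\<dots> < c / 2"
          using t' order.strict_trans1[OF \<open>0 \<le> R\<close> zR] by (simp add: pos_less_divide_eq mult_ac)
        finally have near: "cmod (of_real t' * z - of_real t * z) < c / 2" .
        have c': "c / 2 * norm x \<le> norm (T x - (of_real t' * z) *\<^sub>C x)" for x
        proof -
          have "T x - (of_real t * z) *\<^sub>C x
              = (T x - (of_real t' * z) *\<^sub>C x) + (of_real t' * z - of_real t * z) *\<^sub>C x"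
            by (simp add: scaleC_diff_left)
          then have "norm (T x - (of_real t * z) *\<^sub>C x) \<le> norm (T x - (of_real t' * z) *\<^sub>C x)
              + cmod (of_real t' * z - of_real t * z) * norm x"
            by (metis norm_triangle_ineq norm_scaleC)
          moreover have "cmod (of_real t' * z - of_real t * z) * norm x \<le> c / 2 * norm x"
            using near by (intro mult_right_mono) auto
          ultimately show ?thesis using c[of x] by simp
        qed
        show ?thesis unfolding s_def
        proof
          assume "surj (\<lambda>x. T x - (of_real t' * z) *\<^sub>C x)"
          from surj_diff_scaleC_stable[OF T _ c' this, of "of_real t * z"]
          show "surj (\<lambda>x. T x - (of_real t * z) *\<^sub>C x)"
            using near \<open>0 < c\<close> by (simp add: norm_minus_commute)
        next
          assume "surj (\<lambda>x. T x - (of_real t * z) *\<^sub>C x)"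
          from surj_diff_scaleC_stable[OF T \<open>0 < c\<close> c this, of "of_real t' * z"]
          show "surj (\<lambda>x. T x - (of_real t' * z) *\<^sub>C x)"
            using near \<open>0 < c\<close> by simp
        qed
      qed
      moreover have "0 < c / (2 * cmod z)"
        using \<open>0 < c\<close> order.strict_trans1[OF \<open>0 \<le> R\<close> zR] by simp
      ultimately show ?thesis by blast
    qed
    then have "\<forall>t\<in>U. eventually (\<lambda>t'. s t = s t') (at t within U)"
      unfolding eventually_at by metis
    moreover have "connected U" unfolding U_def by simp
    ultimately have const: "s t \<longleftrightarrow> s 1" if "t \<in> U" for t
      using connected_local_const[of U t 1 s] that by (simp add: U_def)
    obtain K where "0 \<le> K" and K: "\<And>x. norm (T x) \<le> K * norm x"
      using T.nonneg_bounded by (auto simp: mult.commute)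
    \<comment> \<open>Chosen so that \<open>t * z\<close> has modulus \<open>cmod z + K\<close>,
      beyond the operator bound \<open>K\<close>.\<close>
    define t where "t = 1 + K / cmod z"
    have "0 < cmod z" using \<open>0 \<le> R\<close> zR by linarith
    then have "t * cmod z = cmod z + K" by (simp add: t_def field_simps)
    moreover have "cmod (of_real t * z) = t * cmod z"
      using \<open>0 \<le> K\<close> by (simp only: norm_mult norm_of_real) (simp add: t_def)
    ultimately have "K < cmod (of_real t * z)" using \<open>0 < cmod z\<close> by simp
    then have "s t" unfolding s_def by (intro surj_diff_scaleC_large[OF T K \<open>0 \<le> K\<close>])
    then have "s 1" using const[of t] \<open>0 \<le> K\<close> by (simp add: U_def t_def)
    then have "surj (\<lambda>x. T x - z *\<^sub>C x)" by (simp add: s_def)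
    moreover obtain c where "0 < c" "\<And>x. c * norm x \<le> norm (T x - z *\<^sub>C x)"
      using below[OF zR] by blast
    ultimately show False using not_in_op_spectrumI[OF T] z by blast
  qed
qed

section \<open>Approximate eigenvectors of m-partial isometries\<close>

text \<open>The binomial theorem; with \<open>a = (cmod z)\<^sup>2\<close> it evaluates the
  alternating sum on vectors where \<open>T\<close> acts like the scalar \<open>z\<close>.\<close>

lemma sum_alternating_binomial:
  fixes a :: "'a::comm_ring_1"
  shows "(\<Sum>k=0..m. (-1) ^ k * of_nat (m choose k) * a ^ k) = (1 - a) ^ m"
proof -
  have "(- a + 1) ^ m = (\<Sum>k\<le>m. of_nat (m choose k) * (- a) ^ k)"
    by (subst binomial_ring) simp
  then show ?thesis
    by (simp add: atMost_atLeast0 power_minus[of a] mult_ac)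
qed

text \<open>This is the quadratic form of \<open>(-1) ^ m\<close> times \<open>beta_op m T\<close>,
  written with orbit norms so that limits can be taken termwise over the reals.\<close>

definition alt_norm_sum :: "nat \<Rightarrow> ('a::real_normed_vector \<Rightarrow> 'a) \<Rightarrow> 'a \<Rightarrow> real" where
  "alt_norm_sum m T x = (\<Sum>k=0..m. (-1) ^ k * real (m choose k) * (norm ((T ^^ k) x))\<^sup>2)"

text \<open>For the projection \<open>E\<close> onto the kernel of \<open>T\<close>, the sum is the
  squared norm of \<open>E x\<close>. Pythagoras gives the upper bound, and equality forces
  \<open>x = E x\<close>.\<close>

lemma alt_norm_sum_m_partial_isometry:
  fixes T :: "'a::chilbert_space \<Rightarrow> 'a"
  assumes T: "bounded_clinear T" and m: "m_partial_isometry m T"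
  shows "0 \<le> alt_norm_sum m T x" and "alt_norm_sum m T x \<le> (norm x)\<^sup>2"
    and "alt_norm_sum m T x = (norm x)\<^sup>2 \<Longrightarrow> T x = 0"
proof -
  interpret T: bounded_linear T using T by (simp add: bounded_clinear_def)
  have TC: "T (a *\<^sub>C x) = a *\<^sub>C T x" for a x using T by (simp add: bounded_clinear_def)
  define E where "E x = (-1) ^ m *\<^sub>C beta_op m T x" for x
  have sign: "(-1) ^ m * ((-1) ^ (m - k)) = ((-1) ^ k :: complex)" if "k \<le> m" for k
    using that by (auto simp: minus_one_power_iff)
  have E: "cinner (E x) y =
      (\<Sum>k=0..m. (-1) ^ k * of_nat (m choose k) * cinner ((T ^^ k) x) ((T ^^ k) y))" for x y
    unfolding E_def cinner_scaleC_left cinner_beta_op[OF T] sum_distrib_left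
    by (intro sum.cong refl) (simp add: sign flip: mult.assoc)
  have ker: "T (E x) = 0" for x
    using m by (simp add: E_def TC m_partial_isometry_def)
  have T0: "(T ^^ k) 0 = 0" for k by (induction k) (auto simp: T.zero)
  have fix_ker: "E x = x" if "T x = 0" for x
  proof (rule cinner_eqI)
    fix y
    \<comment> \<open>On the kernel only the term \<open>k = 0\<close> of the sum survives.\<close>
    have "(T ^^ k) x = 0" if "k \<noteq> 0" for k
      using that \<open>T x = 0\<close> T0 by (cases k) (auto simp: funpow_swap1)
    then have "cinner (E x) y = (\<Sum>k=0..m. if k = 0 then cinner x y else 0)"
      unfolding E by (intro sum.cong) auto
    then show "cinner (E x) y = cinner x y" by simp
  qed
  have E_sym: "cinner (E x) y = cnj (cinner (E y) x)" for x y
    unfolding E by (simp flip: cinner_commute)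
  have "cinner (E x) x = of_real (alt_norm_sum m T x)"
    unfolding E alt_norm_sum_def by (simp add: cinner_self)
  \<comment> \<open>Symmetry moves one \<open>E\<close> across, and \<open>E (E x) = E x\<close>
    because \<open>E x\<close> lies in the kernel of \<open>T\<close>.\<close>
  moreover have "cinner (E x) (E x) = cnj (cinner (E x) x)"
    using E_sym[of "E x" x] fix_ker[OF ker, of x] E_sym[of x "E x"] by simp
  ultimately have q: "alt_norm_sum m T x = (norm (E x))\<^sup>2" and r: "Re (cinner (E x) x) = (norm (E x))\<^sup>2"
    by (simp_all add: norm_squared_cinner)
  have pyth: "(norm (x - E x))\<^sup>2 = (norm x)\<^sup>2 - (norm (E x))\<^sup>2"
    unfolding norm_diff_squared Re_cinner_commute[of x "E x"] r by simp
  show "0 \<le> alt_norm_sum m T x" by (simp add: q)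
  show "alt_norm_sum m T x \<le> (norm x)\<^sup>2" using pyth q by (smt (verit) zero_le_power2)
  show "T x = 0" if "alt_norm_sum m T x = (norm x)\<^sup>2"
    using that pyth q ker[of x] by simp
qed

text \<open>Unit vectors with \<open>T x - z x\<close> tending to 0 make the alternating sum
  converge to \<open>(1 - (cmod z)\<^sup>2) ^ m\<close>, and the bounds 0 and 1 pass to the limit.
  The equality case is lost in the limit, so eigenvectors are treated separately.\<close>

lemma approx_eigenvalue_bounds:
  fixes T :: "'a::chilbert_space \<Rightarrow> 'a"
  assumes T: "bounded_clinear T" and m: "m_partial_isometry m T"
    and not_below: "\<not> (\<exists>c>0. \<forall>x. c * norm x \<le> norm (T x - z *\<^sub>C x))"
  shows "0 \<le> (1 - (cmod z)\<^sup>2) ^ m" and "(1 - (cmod z)\<^sup>2) ^ m \<le> 1"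
proof -
  interpret T: bounded_linear T using T by (simp add: bounded_clinear_def)
  have TC: "T (a *\<^sub>C x) = a *\<^sub>C T x" for a x using T by (simp add: bounded_clinear_def)
  have "\<exists>x. norm x = 1 \<and> norm (T x - z *\<^sub>C x) < 1 / Suc n" for n
  proof -
    have "\<not> (\<forall>x. 1 / Suc n * norm x \<le> norm (T x - z *\<^sub>C x))"
      using not_below by (metis of_nat_0_less_iff zero_less_Suc zero_less_divide_1_iff)
    then obtain x where x: "norm (T x - z *\<^sub>C x) < 1 / Suc n * norm x" by (auto simp: not_le)
    \<comment> \<open>The strict inequality excludes \<open>x = 0\<close>, so \<open>x\<close> can
      be normalised.\<close>
    then have "0 < norm x" by (metis mult_zero_right norm_ge_zero not_le zero_less_norm_iff norm_zero)
    define y where "y = of_real (1 / norm x) *\<^sub>C x"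
    have "T y - z *\<^sub>C y = of_real (1 / norm x) *\<^sub>C (T x - z *\<^sub>C x)"
      unfolding y_def TC by (simp add: scaleC_diff_right scaleC_scaleC mult.commute)
    then have "norm (T y - z *\<^sub>C y) = norm (T x - z *\<^sub>C x) / norm x"
      by (simp add: norm_scaleC norm_divide)
    also have "\<dots> < 1 / Suc n" using x \<open>0 < norm x\<close> by (simp add: pos_divide_less_eq)
    finally have "norm (T y - z *\<^sub>C y) < 1 / Suc n" .
    moreover have "norm y = 1" using \<open>0 < norm x\<close> by (simp add: y_def norm_scaleC norm_divide)
    ultimately show ?thesis by blast
  qed
  then obtain X where X1: "\<And>n. norm (X n) = 1" and X2: "\<And>n. norm (T (X n) - z *\<^sub>C X n) < 1 / Suc n"
    by metis
  have lim0: "(\<lambda>n. T (X n) - z *\<^sub>C X n) \<longlonglongrightarrow> 0"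
    by (rule LIMSEQ_norm_0) (rule X2)
  have limk: "(\<lambda>n. (T ^^ k) (X n) - z ^ k *\<^sub>C X n) \<longlonglongrightarrow> 0" for k
  proof (induction k)
    case (Suc k)
    \<comment> \<open>The error for \<open>Suc k\<close> splits into \<open>T\<close> applied to the
      error for \<open>k\<close>, plus \<open>z ^ k\<close> times the first-order error.\<close>
    have "(\<lambda>n. T ((T ^^ k) (X n) - z ^ k *\<^sub>C X n)) \<longlonglongrightarrow> 0"
      using T.tendsto[OF Suc] by (simp add: T.zero)
    moreover have "(\<lambda>n. norm (z ^ k *\<^sub>C (T (X n) - z *\<^sub>C X n))) \<longlonglongrightarrow> 0"
      unfolding norm_scaleC using tendsto_mult_right_zero[OF tendsto_norm_zero[OF lim0]] .
    then have "(\<lambda>n. z ^ k *\<^sub>C (T (X n) - z *\<^sub>C X n)) \<longlonglongrightarrow> 0"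
      using tendsto_norm_zero_iff by blast
    ultimately have "(\<lambda>n. T ((T ^^ k) (X n) - z ^ k *\<^sub>C X n) + z ^ k *\<^sub>C (T (X n) - z *\<^sub>C X n))
        \<longlonglongrightarrow> 0 + 0" by (rule tendsto_add)
    moreover have "T ((T ^^ k) (X n) - z ^ k *\<^sub>C X n) + z ^ k *\<^sub>C (T (X n) - z *\<^sub>C X n)
        = (T ^^ Suc k) (X n) - z ^ Suc k *\<^sub>C X n" for n
      by (simp add: T.diff TC scaleC_diff_right scaleC_scaleC mult.commute)
    ultimately show ?case by simp
  qed simp
  have norm_lim: "(\<lambda>n. norm ((T ^^ k) (X n))) \<longlonglongrightarrow> cmod z ^ k" for k
  proof (rule LIM_zero_cancel, rule Lim_null_comparison[OF _ tendsto_norm_zero[OF limk]])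
    show "\<forall>\<^sub>F n in sequentially. norm (norm ((T ^^ k) (X n)) - cmod z ^ k)
        \<le> norm ((T ^^ k) (X n) - z ^ k *\<^sub>C X n)"
      using norm_triangle_ineq3[of "(T ^^ k) (X n)" "z ^ k *\<^sub>C X n" for n]
      by (intro always_eventually allI) (simp add: norm_scaleC X1 norm_power)
  qed
  have "(\<lambda>n. alt_norm_sum m T (X n))
      \<longlonglongrightarrow> (\<Sum>k=0..m. (-1) ^ k * real (m choose k) * (cmod z ^ k)\<^sup>2)"
    unfolding alt_norm_sum_def by (intro tendsto_intros norm_lim)
  then have lim: "(\<lambda>n. alt_norm_sum m T (X n)) \<longlonglongrightarrow> (1 - (cmod z)\<^sup>2) ^ m"
    using sum_alternating_binomial[of m "(cmod z)\<^sup>2"] by (simp add: power_mult[symmetric] mult.commute)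
  show "0 \<le> (1 - (cmod z)\<^sup>2) ^ m"
    using alt_norm_sum_m_partial_isometry(1)[OF T m] by (intro LIMSEQ_le_const[OF lim]) auto
  show "(1 - (cmod z)\<^sup>2) ^ m \<le> 1"
    using alt_norm_sum_m_partial_isometry(2)[OF T m, of "X n" for n]
    by (intro LIMSEQ_le_const2[OF lim]) (simp add: X1)
qed

text \<open>The exact counterpart of the limit computed for approximate eigenvectors, which keeps
  the equality case available.\<close>

lemma alt_norm_sum_eigenvector:
  fixes T :: "'a::complex_inner \<Rightarrow> 'a"
  assumes T: "bounded_clinear T" and x: "T x = z *\<^sub>C x"
  shows "alt_norm_sum m T x = (1 - (cmod z)\<^sup>2) ^ m * (norm x)\<^sup>2"
proof -
  have TC: "T (a *\<^sub>C x) = a *\<^sub>C T x" for a x using T by (simp add: bounded_clinear_def)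
  have "(T ^^ k) x = z ^ k *\<^sub>C x" for k
    by (induction k) (simp_all add: TC x scaleC_scaleC mult.commute)
  then have "alt_norm_sum m T x
      = (\<Sum>k=0..m. (-1) ^ k * real (m choose k) * ((cmod z)\<^sup>2) ^ k * (norm x)\<^sup>2)"
    unfolding alt_norm_sum_def
    by (simp add: norm_scaleC norm_power power_mult_distrib power_mult[symmetric] mult_ac)
  then show ?thesis by (simp add: sum_alternating_binomial flip: sum_distrib_right)
qed

section \<open>Bounds on the spectrum, the point spectrum and the spectral radius\<close>

lemma op_spectral_radius_le:
  assumes "0 \<le> R" and "op_spectrum T \<subseteq> {z. cmod z \<le> R}"
  shows "op_spectral_radius T \<le> R"
  \<comment> \<open>\<open>0 \<le> R\<close> covers the element 0 inserted into the set of
    moduli.\<close>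
  unfolding op_spectral_radius_def using assms by (intro cSup_least) auto

theorem theorem4p2:
  fixes T :: "'a::chilbert_space \<Rightarrow> 'a" and m :: nat
  assumes "m \<ge> 1"
    and "bounded_clinear T"
    and "m_partial_isometry m T"
  shows "(odd m \<longrightarrow> op_spectrum T \<subseteq> {z. cmod z \<le> 1} \<and> op_spectral_radius T \<le> 1) \<and>
    (even m \<longrightarrow> op_spectrum T \<subseteq> {z. cmod z \<le> sqrt 2} \<and>
      op_point_spectrum T \<subseteq> {z. cmod z < sqrt 2} \<and>
      op_spectral_radius T \<le> sqrt 2)"
proof (intro conjI impI)
  note approx = approx_eigenvalue_bounds[OF assms(2,3)]
  have sqrt2: "2 < a\<^sup>2" if "sqrt 2 < a" for a :: real
    using that power_strict_mono[OF that, of 2] by simp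
  show odd: "op_spectrum T \<subseteq> {z. cmod z \<le> 1}" if "odd m"
  proof (rule op_spectrum_subset_disc[OF assms(2)])
    fix z :: complex assume "1 < cmod z"
    then have "1 < (cmod z)\<^sup>2" by (simp add: one_less_power)
    \<comment> \<open>An odd power of a negative number is negative, so \<open>z\<close> cannot be
      an approximate eigenvalue.\<close>
    then have "(1 - (cmod z)\<^sup>2) ^ m < 0" using \<open>odd m\<close> by (simp add: zero_le_odd_power flip: not_le)
    then show "\<exists>c>0. \<forall>x. c * norm x \<le> norm (T x - z *\<^sub>C x)" using approx(1)[of z] by (meson not_le)
  qed simp
  then show "op_spectral_radius T \<le> 1" if "odd m"
    using that by (intro op_spectral_radius_le) auto
  show even: "op_spectrum T \<subseteq> {z. cmod z \<le> sqrt 2}" if "even m"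
  proof (rule op_spectrum_subset_disc[OF assms(2)])
    fix z :: complex assume "sqrt 2 < cmod z"
    \<comment> \<open>\<open>m \<ge> 1\<close> keeps the inequality strict; the even exponent then
      allows the sign of the base to be changed.\<close>
    then have "1 < ((cmod z)\<^sup>2 - 1) ^ m"
      using assms(1) sqrt2[of "cmod z"] by (intro one_less_power) auto
    then have "1 < (1 - (cmod z)\<^sup>2) ^ m"
      using \<open>even m\<close> by (metis minus_diff_eq power_minus_even)
    then show "\<exists>c>0. \<forall>x. c * norm x \<le> norm (T x - z *\<^sub>C x)" using approx(2)[of z] by (meson not_le)
  qed simp
  then show "op_spectral_radius T \<le> sqrt 2" if "even m"
    using that by (intro op_spectral_radius_le) auto
  show "op_point_spectrum T \<subseteq> {z. cmod z < sqrt 2}" if "even m"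
  proof
    fix z assume "z \<in> op_point_spectrum T"
    then obtain x where "x \<noteq> 0" and x: "T x = z *\<^sub>C x" by (auto simp: op_point_spectrum_def)
    note q = alt_norm_sum_eigenvector[OF assms(2) x, of m]
    show "z \<in> {z. cmod z < sqrt 2}"
    proof (rule ccontr)
      assume "z \<notin> {z. cmod z < sqrt 2}"
      then have z: "sqrt 2 \<le> cmod z" by simp
      then have "2 \<le> (cmod z)\<^sup>2" using power_mono[OF z, of 2] by simp
      then have "1 \<le> ((cmod z)\<^sup>2 - 1) ^ m" by (intro one_le_power) auto
      then have "1 \<le> (1 - (cmod z)\<^sup>2) ^ m"
        using \<open>even m\<close> by (metis minus_diff_eq power_minus_even)
      then have "(norm x)\<^sup>2 \<le> alt_norm_sum m T x"
        unfolding q by (simp add: mult_le_cancel_right1)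
      \<comment> \<open>The sum is also at most \<open>(norm x)\<^sup>2\<close>, so equality holds
        and \<open>x\<close> lies in the kernel. This would make \<open>z\<close> zero, against
        \<open>sqrt 2 \<le> cmod z\<close>.\<close>
      then have "T x = 0"
        using alt_norm_sum_m_partial_isometry(2,3)[OF assms(2,3), of x] by linarith
      then have "cmod z * norm x = 0" using x norm_scaleC[of z x] by simp
      then show False using z \<open>x \<noteq> 0\<close> by (auto simp: not_le)
    qed
  qed
qed

end
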